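(* Let $X$ be a topological space and let $Y$ be a convex set in a topological vector space. Let $T\in KKM(Y,X)$ be compact. Let $P:X\to 2^{Y}$ and $Q:Y\to 2^{Y}$ be correspondences such that $P$ is nonempty-valued and $X=\bigcup_{y\in Y}\operatorname{Int}(G')^{-1}(y)$, where $G':X\to 2^{Y}$ is defined by $G'(x)=\{y\in Y:P(x)\cap Q(y)\neq\emptyset\}$ for each $x\in X$. Then there exist an integer $n\ge 2$, points $y_1^{\ast},\dots,y_n^{\ast}\in Y$, a point $y^{\ast}\in\operatorname{co}\{y_1^{\ast},\dots,y_n^{\ast}\}$ and $x^{\ast}\in T(y^{\ast})$ such that $Q(y_i^{\ast})\cap P(x^{\ast})\neq\emptyset$ for each $i\in\{1,\dots,n\}$.
   Context: A correspondence $T:Y\to 2^{X}$ assigns to each $y\in Y$ a subset $T(y)\subset X$; $T(B)=\bigcup_{y\in B}T(y)$ for $B\subset Y$. $T$ is compact if $\overline{T(Y)}$ is a compact subset of $X$. For $G':X\to 2^{Y}$, $(G')^{-1}(y)=\{x\in X:y\in G'(x)\}$. $\operatorname{co}$ denotes the convex hull. Given $T,H:Y\to 2^{X}$, $H$ is a generalized KKM mapping w.r.t. $T$ if $T(\operatorname{co}B)\subset H(B)$ for each finite $B\subset Y$. $KKM(Y,X)$ is the set of $T:Y\to 2^{X}$ having the KKM property: for every $H:Y\to 2^{X}$ which is a generalized KKM mapping w.r.t. $T$, the family $\{\overline{H(y)}:y\in Y\}$ has the finite intersection property. *)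

theory Defs
  imports "HOL-Analysis.Analysis"
begin

(* Real topological vector spaces; as the literature is divided on the point,
   no separation axiom is required. *)
class real_tvs = topological_ab_group_add + real_vector +
  assumes tendsto_scaleR_nhds_prod:
    "((\<lambda>p. fst p *\<^sub>R snd p) \<longlongrightarrow> a *\<^sub>R x) (nhds (a::real) \<times>\<^sub>F nhds x)"

instance real_normed_vector \<subseteq> real_tvs
proof
  fix a :: real and x :: 'a
  show "((\<lambda>p. fst p *\<^sub>R snd p) \<longlongrightarrow> a *\<^sub>R x) (nhds a \<times>\<^sub>F nhds x)"
    by (intro tendsto_scaleR filterlim_fst filterlim_snd)
qed

(* A correspondence Y -> 2^X is a set-valued function of which only the values at
   points of the carrier Y matter. *)

definition has_fip :: "'a set set \<Rightarrow> bool" where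
  "has_fip \<F> \<longleftrightarrow> (\<forall>\<G>. finite \<G> \<and> \<G> \<subseteq> \<F> \<longrightarrow> \<Inter>\<G> \<noteq> {})"

definition generalized_KKM_mapping ::
    "'b::real_vector set \<Rightarrow> ('b \<Rightarrow> 'a set) \<Rightarrow> ('b \<Rightarrow> 'a set) \<Rightarrow> bool" where
  "generalized_KKM_mapping Y T H \<longleftrightarrow>
     (\<forall>B. finite B \<and> B \<subseteq> Y \<longrightarrow> (\<Union>y\<in>convex hull B. T y) \<subseteq> (\<Union>y\<in>B. H y))"

definition KKM :: "'b::real_vector set \<Rightarrow> ('b \<Rightarrow> 'a::topological_space set) set" where
  "KKM Y = {T. \<forall>H. generalized_KKM_mapping Y T H \<longrightarrow> has_fip ((\<lambda>y. closure (H y)) ` Y)}"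

definition compact_correspondence :: "'b set \<Rightarrow> ('b \<Rightarrow> 'a::topological_space set) \<Rightarrow> bool" where
  "compact_correspondence Y T \<longleftrightarrow> compact (closure (\<Union>y\<in>Y. T y))"

definition inverse_correspondence :: "('a \<Rightarrow> 'b set) \<Rightarrow> 'b \<Rightarrow> 'a set" where
  "inverse_correspondence G y = {x. y \<in> G x}"

definition meeting_correspondence ::
    "'b set \<Rightarrow> ('a \<Rightarrow> 'b set) \<Rightarrow> ('b \<Rightarrow> 'b set) \<Rightarrow> 'a \<Rightarrow> 'b set" where
  "meeting_correspondence Y P Q x = {y \<in> Y. P x \<inter> Q y \<noteq> {}}"

end

theory Submission
  imports Defs
begin

text \<open>
  Write \<open>U y\<close> for the interior of the set of all \<open>x\<close> with \<open>P x \<inter> Q y \<noteq> {}\<close>. The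
  open sets \<open>U y\<close> cover the space, so finitely many of them cover the compact closure of the range
  of \<open>T\<close>. Removing \<open>U y\<close> from this range, for each \<open>y\<close>, gives a mapping whose values at
  these finitely many \<open>y\<close> have closures with no common point. As \<open>T\<close> has the KKM
  property, this mapping cannot be a generalized KKM mapping: some \<open>x\<close> in the image under \<open>T\<close>
  of the convex hull of a finite set \<open>B\<close> lies in \<open>U b\<close> for every \<open>b \<in> B\<close>
  (\<open>KKM_open_cover_coincidence\<close>). The elements of \<open>B\<close> are the required points \<open>ys i\<close>.
\<close>

text \<open>Repetitions are what makes a length of at least two possible for a singleton.\<close>

lemma finite_nonempty_enumeration_ge2:
  assumes "finite B" "B \<noteq> {}"
  shows "\<exists>n (f :: nat \<Rightarrow> 'a). n \<ge> 2 \<and> f ` {1..n} = B"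
  using assms
proof (induction rule: finite_ne_induct)
  case (singleton b)
  have "(\<lambda>_::nat. b) ` {1..2} = {b}"
    by (simp add: image_constant_conv)
  then show ?case
    by blast
next
  case (insert b B)
  then obtain n and f :: "nat \<Rightarrow> 'a" where n: "n \<ge> 2" and f: "f ` {1..n} = B"
    by blast
  have "(f(Suc n := b)) ` {1..Suc n} = insert b (f ` {1..n})"
    by (auto simp: atLeastAtMostSuc_conv image_iff)
  then have "2 \<le> Suc n \<and> (f(Suc n := b)) ` {1..Suc n} = insert b B"
    using n f by simp
  then show ?case
    by blast
qed

text \<open>
  This is the KKM principle in its open-cover form: the KKM property speaks of closures of the
  values of a mapping, and for the complements of open sets relative to the range of \<open>T\<close> these
  closures still miss the open sets.
\<close>

lemma KKM_open_cover_coincidence: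
  fixes Y :: "'b::real_vector set" and T :: "'b \<Rightarrow> 'a::topological_space set"
  assumes "convex Y" and KKM: "T \<in> KKM Y" and cpt: "compact_correspondence Y T"
    and op: "\<And>y. y \<in> Y \<Longrightarrow> open (U y)"
    and cover: "(\<Union>y\<in>Y. U y) = UNIV"
  obtains B y x where "finite B" "B \<subseteq> Y" "y \<in> convex hull B" "x \<in> T y"
    "\<And>b. b \<in> B \<Longrightarrow> x \<in> U b"
proof -
  define R where "R = (\<Union>y\<in>Y. T y)"
  define H where "H y = R - U y" for y
  have "compact (closure R)"
    using cpt by (simp add: compact_correspondence_def R_def)
  then obtain F where F: "F \<subseteq> Y" "finite F" "closure R \<subseteq> (\<Union>y\<in>F. U y)"
    using compactE_image[OF \<open>compact (closure R)\<close>, of Y U] op cover by (metis subset_UNIV)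
  \<comment> \<open>If \<open>R\<close> is empty, \<open>F\<close> may be empty too, and then the intersection over \<open>F\<close> would be
    the whole space; the extra index \<open>y0\<close> prevents this.\<close>
  obtain y0 where y0: "y0 \<in> Y"
    using cover by blast
  have sub: "closure (H y) \<subseteq> closure R \<inter> - U y" if "y \<in> Y" for y
  proof (rule closure_minimal)
    show "H y \<subseteq> closure R \<inter> - U y"
      using closure_subset[of R] by (auto simp: H_def)
    show "closed (closure R \<inter> - U y)"
      using op[OF that] by (simp add: closed_Int closed_Compl)
  qed
  have False if z: "z \<in> (\<Inter>y\<in>insert y0 F. closure (H y))" for z
  proof -
    have *: "z \<in> closure R \<inter> - U y" if "y \<in> insert y0 F" for y
      using sub[of y] that F(1) y0 z by blast
    show False
      using *[of y0] * F(3) by blast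
  qed
  then have "(\<Inter>y\<in>insert y0 F. closure (H y)) = {}"
    by blast
  moreover have "finite ((\<lambda>y. closure (H y)) ` insert y0 F)"
    "(\<lambda>y. closure (H y)) ` insert y0 F \<subseteq> (\<lambda>y. closure (H y)) ` Y"
    using F y0 by auto
  ultimately have "\<not> has_fip ((\<lambda>y. closure (H y)) ` Y)"
    unfolding has_fip_def by blast
  then have "\<not> generalized_KKM_mapping Y T H"
    using KKM by (auto simp: KKM_def)
  then obtain B y x where B: "finite B" "B \<subseteq> Y" "y \<in> convex hull B" "x \<in> T y"
    and x: "x \<notin> (\<Union>b\<in>B. H b)"
    unfolding generalized_KKM_mapping_def by blast
  have "y \<in> Y"
    using hull_minimal[of B Y convex] B \<open>convex Y\<close> by blast
  then have "x \<in> R"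
    using B by (auto simp: R_def)
  then have "x \<in> U b" if "b \<in> B" for b
    using x that by (auto simp: H_def)
  with B show thesis
    using that by blast
qed

theorem theorem6:
  fixes Y :: "'b::real_tvs set"
    and T :: "'b \<Rightarrow> 'a::topological_space set"
    and P :: "'a \<Rightarrow> 'b set"
    and Q :: "'b \<Rightarrow> 'b set"
  assumes "convex Y"
    and "T \<in> KKM Y"
    and "compact_correspondence Y T"
    and "\<And>x. P x \<subseteq> Y"
    and "\<And>y. y \<in> Y \<Longrightarrow> Q y \<subseteq> Y"
    and "\<And>x. P x \<noteq> {}"
    and "(UNIV :: 'a set) =
      (\<Union>y\<in>Y. interior (inverse_correspondence (meeting_correspondence Y P Q) y))"
  shows "\<exists>(n::nat) (ys :: nat \<Rightarrow> 'b) y x.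
    n \<ge> 2 \<and> (\<forall>i\<in>{1..n}. ys i \<in> Y) \<and> y \<in> convex hull (ys ` {1..n}) \<and> x \<in> T y \<and>
    (\<forall>i\<in>{1..n}. Q (ys i) \<inter> P x \<noteq> {})"
proof -
  define U where "U y = interior (inverse_correspondence (meeting_correspondence Y P Q) y)" for y
  have "(\<Union>y\<in>Y. U y) = UNIV"
    using assms(7) by (simp add: U_def)
  then obtain B y x where B: "finite B" "B \<subseteq> Y" "y \<in> convex hull B" "x \<in> T y"
    and x: "\<And>b. b \<in> B \<Longrightarrow> x \<in> U b"
    using KKM_open_cover_coincidence[OF assms(1-3), of U] unfolding U_def by (metis open_interior)
  have meet: "Q b \<inter> P x \<noteq> {}" if "b \<in> B" for b
    using subsetD[OF interior_subset x[OF that, unfolded U_def]]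
    by (simp add: inverse_correspondence_def meeting_correspondence_def Int_commute)
  have "B \<noteq> {}"
    using B by auto
  then obtain n and ys :: "nat \<Rightarrow> 'b" where ys: "n \<ge> 2" "ys ` {1..n} = B"
    using finite_nonempty_enumeration_ge2[OF \<open>finite B\<close>] by blast
  then have "\<forall>i\<in>{1..n}. ys i \<in> B"
    by blast
  then have "\<forall>i\<in>{1..n}. ys i \<in> Y" "\<forall>i\<in>{1..n}. Q (ys i) \<inter> P x \<noteq> {}"
    using B meet by blast+
  with ys B show ?thesis
    by blast
qed

end
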